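(* Let $(X,\mathcal{X})$ be a measurable space such that there is a countable subset of $\mathcal{X}$ which separates the points of $X$ (equivalently, $(X,\mathcal{X})$ has a measurable diagonal). Then, for each $n\in\mathbb{N}$, the set $$\big\{(x_1,\ldots,x_n)\in X^n : x_1=\cdots=x_n\big\}$$ belongs to the $n$-fold product sigma-algebra $\mathcal{X}^n$.
   Context: $\mathbb{N}$ is the set of positive integers. $\mathcal{X}^n$ is the $n$-fold product sigma-algebra $\mathcal{X}\otimes\cdots\otimes\mathcal{X}$ on $X^n$. A family $\mathcal{E}$ of subsets of $X$ separates the points of $X$ if for any two distinct points $x,y\in X$ there exists $E\in\mathcal{E}$ such that either $x\in E$ and $y\notin E$, or $y\in E$ and $x\notin E$. "Countable" means at most countable. $(X,\mathcal{X})$ has a measurable diagonal if $\{(x,x):x\in X\}\in\mathcal{X}\otimes\mathcal{X}$; it is a known theorem (Bogachev, Measure Theory, Theorem 6.5.7) that this is equivalent to the existence of a countable subset of $\mathcal{X}$ separating the points of $X$. *)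

theory Defs
  imports "HOL-Analysis.Analysis"
begin

definition separates_points :: "'a set set \<Rightarrow> 'a set \<Rightarrow> bool" where
  "separates_points \<E> X \<longleftrightarrow>
     (\<forall>x\<in>X. \<forall>y\<in>X. x \<noteq> y \<longrightarrow>
        (\<exists>E\<in>\<E>. (x \<in> E \<and> y \<notin> E) \<or> (y \<in> E \<and> x \<notin> E)))"

end

theory Submission
  imports Defs
begin

text \<open>
  A point of a space whose points are separated by \<open>\<E>\<close> is determined by which members of \<open>\<E>\<close>
  contain it. Hence two coordinates of a tuple agree exactly when every \<open>E \<in> \<E>\<close> contains both of
  them or neither. For fixed \<open>i\<close>, \<open>j\<close> and \<open>E\<close> this last condition is measurable, since it only
  involves the preimages of \<open>E\<close> under two coordinate projections; and as \<open>\<E>\<close> is countable, the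
  diagonal is a countable intersection of such sets. The argument works
  for countably many factors.
\<close>

lemma separates_points_eq_iff:
  assumes "separates_points \<E> X" "x \<in> X" "y \<in> X"
  shows "x = y \<longleftrightarrow> (\<forall>E\<in>\<E>. x \<in> E \<longleftrightarrow> y \<in> E)"
  using assms unfolding separates_points_def by blast

lemma sets_PiM_diagonal:
  assumes "countable I" "countable \<E>" "\<E> \<subseteq> sets M" "separates_points \<E> (space M)"
  shows "{x \<in> I \<rightarrow>\<^sub>E space M. \<forall>i\<in>I. \<forall>j\<in>I. x i = x j} \<in> sets (Pi\<^sub>M I (\<lambda>_. M))"
proof -
  let ?P = "Pi\<^sub>M I (\<lambda>_. M)"
  have "{x \<in> space ?P. x i \<in> E \<longleftrightarrow> x j \<in> E} \<in> sets ?P"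
    if "i \<in> I" "j \<in> I" "E \<in> \<E>" for i j E
  proof -
    have [measurable]: "E \<in> sets M"
      using assms(3) that(3) by blast
    have [measurable]: "(\<lambda>x. x i) \<in> measurable ?P M" "(\<lambda>x. x j) \<in> measurable ?P M"
      using that by (auto intro: measurable_component_singleton)
    show ?thesis
      by measurable
  qed
  then have "{x \<in> space ?P. \<forall>i\<in>I. \<forall>j\<in>I. \<forall>E\<in>\<E>. x i \<in> E \<longleftrightarrow> x j \<in> E} \<in> sets ?P"
    using assms(1,2) by - (intro sets.sets_Collect_countable_All', auto)
  also have "{x \<in> space ?P. \<forall>i\<in>I. \<forall>j\<in>I. \<forall>E\<in>\<E>. x i \<in> E \<longleftrightarrow> x j \<in> E}
      = {x \<in> I \<rightarrow>\<^sub>E space M. \<forall>i\<in>I. \<forall>j\<in>I. x i = x j}"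
    using separates_points_eq_iff[OF assms(4)]
    by (intro Collect_cong conj_cong ball_cong refl) (auto simp: space_PiM PiE_mem)
  finally show ?thesis .
qed

theorem lemma3p2:
  fixes M :: "'a measure" and n :: nat
  assumes "\<exists>\<E>. \<E> \<subseteq> sets M \<and> countable \<E> \<and> separates_points \<E> (space M)"
    and "n \<ge> 1"
  shows "{x \<in> {1..n} \<rightarrow>\<^sub>E space M. \<forall>i\<in>{1..n}. \<forall>j\<in>{1..n}. x i = x j}
           \<in> sets (Pi\<^sub>M {1..n} (\<lambda>_. M))"
  using assms(1) by (auto intro: sets_PiM_diagonal)

end
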